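(* Every positive integer $n\equiv 4\pmod 5$ that is a sum of three squares of integers is a sum of three nonunit squares, except for $n=14$ and $n=19$.
   Context: A positive integer $n$ is called a sum of three nonunit squares if there exist integers $x,y,z$ with $n=x^2+y^2+z^2$ and $(x^2-1)(y^2-1)(z^2-1)\neq 0$ (zero is allowed as a value of $x,y,z$). *)

theory Defs
  imports "HOL-Number_Theory.Cong"
begin

definition sum_of_three_squares :: "int \<Rightarrow> bool" where
  "sum_of_three_squares n \<longleftrightarrow> (\<exists>x y z :: int. n = x^2 + y^2 + z^2)"

definition sum_of_three_nonunit_squares :: "int \<Rightarrow> bool" where
  "sum_of_three_nonunit_squares n \<longleftrightarrow>
     (\<exists>x y z :: int. n = x^2 + y^2 + z^2 \<and> (x^2 - 1) * (y^2 - 1) * (z^2 - 1) \<noteq> 0)"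

end

theory Submission
  imports Defs
begin

text \<open>
  Modulo 5 the squares are 0, 1, 4, so if a representation of \<open>n\<close> contains a unit, the other two
  entries are congruent to 2 up to sign. An entry \<open>y = 2 + 5 k\<close> can be combined with the unit by
  the rational rotation with matrix entries 3/5 and 4/5:
  \<open>1 + y\<^sup>2 = (2 + 3 k)\<^sup>2 + (1 + 4 k)\<^sup>2\<close>. This removes the unit unless \<open>k\<close> is 0 or -1, that is
  unless \<open>y\<close> is 2 or 3 up to sign. If that fails for both entries, \<open>n\<close> is 9, 14 or 19, and
  \<open>9 = 3\<^sup>2 + 0\<^sup>2 + 0\<^sup>2\<close>.
\<close>

lemma square_mod_5:
  fixes y :: int
  shows "y\<^sup>2 mod 5 = (if y mod 5 = 0 then 0 else if y mod 5 \<in> {1, 4} then 1 else 4)"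
proof -
  have "y mod 5 \<in> {0, 1, 2, 3, 4}" by auto
  moreover have "y\<^sup>2 mod 5 = (y mod 5)\<^sup>2 mod 5" by (simp add: power_mod)
  ultimately show ?thesis by auto
qed

text \<open>Only the square matters, so the sign of \<open>y\<close> is free and residue 3 reduces
  to residue 2; \<open>k\<close> may be negative.\<close>

lemma square_mod_5_eq_4E:
  fixes y :: int
  assumes "y\<^sup>2 mod 5 = 4"
  obtains k where "y\<^sup>2 = (2 + 5 * k)\<^sup>2"
proof -
  have "y mod 5 = 2 \<or> y mod 5 = 3"
    using assms by (simp add: square_mod_5 split: if_splits) presburger
  then have "(\<exists>k. y = 2 + 5 * k) \<or> (\<exists>k. y = - (2 + 5 * k))" by presburger
  then show ?thesis using that by (metis power2_minus)
qed

lemma nonunit_squares_of_unit: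
  fixes y z :: int
  assumes "y\<^sup>2 mod 5 = 4" and "y\<^sup>2 \<noteq> 4" and "y\<^sup>2 \<noteq> 9" and "z\<^sup>2 \<noteq> 1"
  shows "sum_of_three_nonunit_squares (1 + y\<^sup>2 + z\<^sup>2)"
proof -
  obtain k where k: "y\<^sup>2 = (2 + 5 * k)\<^sup>2" using assms(1) by (rule square_mod_5_eq_4E)
  have "k \<noteq> 0" "k \<noteq> -1" using assms k by auto
  \<comment> \<open>\<open>2 + 3 * k\<close> is 1 or -1 only for \<open>k = -1\<close>, and
    \<open>1 + 4 * k\<close> only for \<open>k = 0\<close>.\<close>
  then have "(2 + 3 * k)\<^sup>2 \<noteq> 1" "(1 + 4 * k)\<^sup>2 \<noteq> 1"
    unfolding power2_eq_1_iff by presburger+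
  \<comment> \<open>With \<open>w = 2 + 5 * k\<close>, the rotated entries are (3w + 4)/5 and (4w -
    3)/5, which this residue of \<open>w\<close> makes integral.\<close>
  moreover have "1 + y\<^sup>2 = (2 + 3 * k)\<^sup>2 + (1 + 4 * k)\<^sup>2"
    unfolding k by (simp add: power2_eq_square algebra_simps)
  ultimately show ?thesis
    unfolding sum_of_three_nonunit_squares_def using assms(4)
    by (intro exI[of _ "2 + 3 * k"] exI[of _ "1 + 4 * k"] exI[of _ z]) simp
qed

lemma nonunit_squares_if_unit_representation:
  fixes y z :: int
  assumes n: "n = 1 + y\<^sup>2 + z\<^sup>2" and "[n = 4] (mod 5)" and "n \<noteq> 14" and "n \<noteq> 19"
  shows "sum_of_three_nonunit_squares n"
proof -
  have "(1 + y\<^sup>2 + z\<^sup>2) mod 5 = 4" using assms(1,2) by (simp add: cong_def)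
  moreover have "y\<^sup>2 mod 5 \<in> {0, 1, 4}" "z\<^sup>2 mod 5 \<in> {0, 1, 4}" by (auto simp: square_mod_5)
  \<comment> \<open>The two squares sum to 3 modulo 5, and among the residues 0, 1, 4 only 4 + 4
    does so.\<close>
  ultimately have y4: "y\<^sup>2 mod 5 = 4" and z4: "z\<^sup>2 mod 5 = 4"
    unfolding insert_iff empty_iff by presburger+
  then have y1: "y\<^sup>2 \<noteq> 1" and z1: "z\<^sup>2 \<noteq> 1" by auto
  consider "y\<^sup>2 \<noteq> 4" "y\<^sup>2 \<noteq> 9" | "z\<^sup>2 \<noteq> 4" "z\<^sup>2 \<noteq> 9" | "y\<^sup>2 \<in> {4, 9}" "z\<^sup>2 \<in> {4, 9}" by blast
  then show ?thesis
  proof cases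
    case 1
    with nonunit_squares_of_unit[OF y4 _ _ z1] n show ?thesis by simp
  next
    case 2
    with nonunit_squares_of_unit[OF z4 _ _ y1] n show ?thesis by (simp add: ac_simps)
  next
    case 3
    with assms have "n = 9" by auto
    then show ?thesis
      unfolding sum_of_three_nonunit_squares_def
      by (intro exI[of _ 3] exI[of _ 0]) simp
  qed
qed

text \<open>A finite check: the nonunit squares up to 19 are 0, 4, 9 and 16, and no three of them,
  repetition allowed, sum to 14 or 19.\<close>

lemma not_nonunit_squares_14_19:
  assumes "n = 14 \<or> n = 19"
  shows "\<not> sum_of_three_nonunit_squares n"
proof
  assume "sum_of_three_nonunit_squares n"
  then obtain x y z :: int where n: "n = x\<^sup>2 + y\<^sup>2 + z\<^sup>2"
    and nz: "(x\<^sup>2 - 1) * (y\<^sup>2 - 1) * (z\<^sup>2 - 1) \<noteq> 0"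
    unfolding sum_of_three_nonunit_squares_def by blast
  have small: "w\<^sup>2 \<in> {0, 1, 4, 9, 16}" if "w\<^sup>2 \<le> 19" for w :: int
  proof -
    have "\<bar>w\<bar> < 5" using that by (intro power2_less_imp_less[of _ 5]) auto
    then have "w \<in> {-4, -3, -2, -1, 0, 1, 2, 3, 4}" by auto
    then show ?thesis by auto
  qed
  have "x\<^sup>2 \<le> 19" "y\<^sup>2 \<le> 19" "z\<^sup>2 \<le> 19"
    using n assms zero_le_power2[of x] zero_le_power2[of y] zero_le_power2[of z] by linarith+
  then have "x\<^sup>2 \<in> {0, 4, 9, 16}" "y\<^sup>2 \<in> {0, 4, 9, 16}" "z\<^sup>2 \<in> {0, 4, 9, 16}"
    using small[of x] small[of y] small[of z] nz by auto
  then show False using n assms by (elim insertE emptyE) simp_all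
qed

theorem theorem2p4:
  fixes n :: int
  assumes "n > 0"
    and "[n = 4] (mod 5)"
    and "sum_of_three_squares n"
  shows "sum_of_three_nonunit_squares n \<longleftrightarrow> n \<noteq> 14 \<and> n \<noteq> 19"
proof
  show "n \<noteq> 14 \<and> n \<noteq> 19" if "sum_of_three_nonunit_squares n"
    using that not_nonunit_squares_14_19 by blast
next
  assume ne: "n \<noteq> 14 \<and> n \<noteq> 19"
  obtain x y z :: int where n: "n = x\<^sup>2 + y\<^sup>2 + z\<^sup>2"
    using assms(3) unfolding sum_of_three_squares_def by blast
  \<comment> \<open>The sum is symmetric in its entries, so this one fact serves whichever of them
    is the unit.\<close>
  note unit = nonunit_squares_if_unit_representation[OF _ assms(2)]
  consider "x\<^sup>2 = 1" | "y\<^sup>2 = 1" | "z\<^sup>2 = 1" | "x\<^sup>2 \<noteq> 1" "y\<^sup>2 \<noteq> 1" "z\<^sup>2 \<noteq> 1" by blast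
  then show "sum_of_three_nonunit_squares n"
  proof cases
    case 1
    with n ne unit[of y z] show ?thesis by simp
  next
    case 2
    with n ne unit[of x z] show ?thesis by simp
  next
    case 3
    with n ne unit[of x y] show ?thesis by simp
  next
    case 4
    with n show ?thesis unfolding sum_of_three_nonunit_squares_def by auto
  qed
qed

end
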